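(* Let $(m,n,k)\in\mathbb{Z}^3$ be such that $k^2-4mn>0$ is not a perfect square. The period $\Gamma(m,n,k)$ is non-palindromic and odd if and only if the class $C(m,n,k)$ is antisymmetric.
   Context: The triple $\mathbf f=(m,n,k)\in\mathbb{Z}^3$ denotes the binary quadratic form $f(x,y)=mx^2+ny^2+kxy$. The class $C(\mathbf f)=C(m,n,k)$ is the orbit of $\mathbf f$ under the action of $\mathrm{SL}(2,\mathbb{Z})$ by linear changes of the variables $(x,y)$. For $\mathbf f=(m,n,k)$ define the conjugate $\overline{\mathbf f}=(m,n,-k)$, the adjoint $\mathbf f^*=(-n,-m,k)$ and the antipodal $\overline{\mathbf f}^*=(-n,-m,-k)$. If a class contains one form together with its image under one of these involutions, the whole class is invariant under that involution. A class is called antisymmetric if it is invariant under the antipodal involution but not under the conjugation nor the adjoint involution. For $k^2-4mn>0$ not a perfect square, put $\xi^{+}(\mathbf f)=\frac{-k+\sqrt{k^2-4mn}}{2m}$; its (regular) continued fraction is eventually periodic (the continued fraction of a negative number $\xi$ is written $-[\alpha_0,\alpha_1,\dots]$, where $[\alpha_0,\alpha_1,\dots]$ is that of $|\xi|$). $\Gamma(m,n,k)$ denotes its period, i.e. its minimal repeating block of positive integers, considered up to cyclic permutation. A period is even (odd) if its length is even (odd). A period is palindromic if some cyclic permutation of it is equal to the same sequence written backwards. *)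

theory Defs
  imports
    Complex_Main
    "HOL-Analysis.Determinants"
    "HOL-Computational_Algebra.Nth_Powers"
begin

section \<open>Integral binary quadratic forms and their classes\<close>

text \<open>The triple \<open>(m, n, k)\<close> stands for the form \<open>m x\<^sup>2 + n y\<^sup>2 + k x y\<close>: the mixed
  coefficient comes last.\<close>

type_synonym form = "int \<times> int \<times> int"

fun form_eval :: "form \<Rightarrow> int ^ 2 \<Rightarrow> int" where
  "form_eval (m, n, k) v = m * (v $ 1)\<^sup>2 + n * (v $ 2)\<^sup>2 + k * (v $ 1) * (v $ 2)"

text \<open>An integral form is determined by its values on \<open>\<int>\<^sup>2\<close>, so the equation below says
  exactly that \<open>g\<close> arises from \<open>f\<close> by the change of variables \<open>A\<close>.\<close>

definition form_class :: "form \<Rightarrow> form set" where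
  "form_class f = {g. \<exists>A :: int ^ 2 ^ 2. det A = 1 \<and> (\<forall>v. form_eval g v = form_eval f (A *v v))}"

fun conjugate_form :: "form \<Rightarrow> form" where
  "conjugate_form (m, n, k) = (m, n, - k)"

fun adjoint_form :: "form \<Rightarrow> form" where
  "adjoint_form (m, n, k) = (- n, - m, k)"

fun antipodal_form :: "form \<Rightarrow> form" where
  "antipodal_form (m, n, k) = (- n, - m, - k)"

definition invariant_under :: "(form \<Rightarrow> form) \<Rightarrow> form set \<Rightarrow> bool" where
  "invariant_under \<sigma> C \<longleftrightarrow> \<sigma> ` C = C"

definition antisymmetric_class :: "form set \<Rightarrow> bool" where
  "antisymmetric_class C \<longleftrightarrow>
     invariant_under antipodal_form C \<and>
     \<not> invariant_under conjugate_form C \<and>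
     \<not> invariant_under adjoint_form C"


section \<open>Regular continued fractions and their periods\<close>

text \<open>Complete quotients and partial quotients of the regular continued fraction of \<open>x\<close>. These
  are meaningful for irrational \<open>x\<close>, where the expansion does not terminate.\<close>

primrec complete_quotient :: "real \<Rightarrow> nat \<Rightarrow> real" where
  "complete_quotient x 0 = x"
| "complete_quotient x (Suc i) = 1 / frac (complete_quotient x i)"

definition partial_quotient :: "real \<Rightarrow> nat \<Rightarrow> int" where
  "partial_quotient x i = \<lfloor>complete_quotient x i\<rfloor>"

definition repeating_block :: "(nat \<Rightarrow> 'a) \<Rightarrow> 'a list \<Rightarrow> bool" where
  "repeating_block a xs \<longleftrightarrow>
     xs \<noteq> [] \<and> (\<exists>N. \<forall>i. a (N + i) = xs ! (i mod length xs))"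

text \<open>The period of an eventually periodic sequence, considered up to cyclic permutation, is
  represented by the set of all its minimal repeating blocks. Since the starting index \<open>N\<close> in
  \<open>repeating_block\<close> is arbitrary, this set is closed under rotation, and any two of
  its members are rotations of each other.\<close>

definition minimal_blocks :: "(nat \<Rightarrow> 'a) \<Rightarrow> 'a list set" where
  "minimal_blocks a =
     {xs. repeating_block a xs \<and> (\<forall>ys. repeating_block a ys \<longrightarrow> length xs \<le> length ys)}"

fun xi_plus :: "form \<Rightarrow> real" where
  "xi_plus (m, n, k) =
     (- real_of_int k + sqrt (real_of_int (k\<^sup>2 - 4 * m * n))) / (2 * real_of_int m)"

text \<open>The continued fraction of a negative number is minus that of its absolute value, hence
  the absolute value.\<close>

definition form_period :: "form \<Rightarrow> int list set" where
  "form_period f = minimal_blocks (partial_quotient \<bar>xi_plus f\<bar>)"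

text \<open>Both predicates are invariant under rotation of the block, so it does not matter which
  member of the period is used. In particular, both are false for the empty set, which is the
  set of minimal blocks of a sequence that is not eventually periodic.\<close>

definition odd_period :: "'a list set \<Rightarrow> bool" where
  "odd_period P \<longleftrightarrow> (\<exists>xs\<in>P. odd (length xs))"

text \<open>Palindromic means that the cyclic sequence coincides with its reversal. For a block of odd
  length this is the same as having a rotation \<open>ys\<close> with \<open>rev ys = ys\<close>.\<close>

definition palindromic_period :: "'a list set \<Rightarrow> bool" where
  "palindromic_period P \<longleftrightarrow> (\<exists>xs\<in>P. \<exists>i. rotate i xs = rev xs)"

end

theory Submission
  imports Defs
begin

text \<open>
  Let \<open>x\<close> and \<open>x'\<close> be the two roots of \<open>m X\<^sup>2 + k X + n\<close>. Both sides of the theorem can be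
  read off from the integer matrices of determinant \<open>e = \<plusminus>1\<close> whose Moebius action fixes \<open>x\<close> or
  exchanges it with \<open>x'\<close>.

  On the side of forms, each of the three involutions is a fixed substitution of determinant
  \<open>\<plusminus>1\<close> followed by multiplication with \<open>\<plusminus>1\<close>. Hence a class is invariant under the involution if
  and only if some substitution of the right determinant \<open>e\<close> turns \<open>f\<close> into \<open>f\<close> or into \<open>- f\<close>
  (\<open>invariant_under_form_class_iff\<close>). Such a substitution permutes the two roots. It fixes them
  if \<open>f\<close> becomes \<open>e f\<close> and exchanges them if \<open>f\<close> becomes \<open>- e f\<close>
  (\<open>form_equiv_scale_iff_moebius\<close>). So the class is antipodally invariant iff a matrix of
  determinant \<open>-1\<close> fixes \<open>x\<close>; it is invariant under conjugation (adjunction) iff a matrix of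
  determinant \<open>-1\<close> (of determinant \<open>1\<close>) sends \<open>x\<close> to \<open>x'\<close>.

  On the side of continued fractions, Serret's theorem says that two irrational numbers are
  related by a matrix of determinant \<open>e\<close> iff some complete quotients of theirs agree at indices
  \<open>i\<close> and \<open>j\<close> with \<open>(-1)\<^bsup>i+j\<^esup> = e\<close> (\<open>moebius_equiv_imp_common_tail\<close>, \<open>common_tail_imp_moebius_equiv\<close>).
  For \<open>x\<close> and \<open>x\<close> itself this makes a matrix of determinant \<open>-1\<close> the same thing as an odd period
  (\<open>odd_period_iff\<close>). For \<open>x\<close> and \<open>x'\<close> it combines with Galois' theorem, by which the
  period of \<open>x'\<close> is that of \<open>x\<close> read backwards, and yields that the period is a palindrome iff
  some matrix sends \<open>x\<close> to \<open>x'\<close> (\<open>palindromic_period_iff\<close>).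

  Galois' theorem is about periodic expansions. Either side of the equivalence provides one: an
  odd period by itself, and an antipodally invariant class through the matrix of determinant
  \<open>-1\<close> that fixes \<open>x\<close>.
\<close>

section \<open>Continued fraction expansions of irrational numbers\<close>

lemma complete_quotient_complete_quotient:
  "complete_quotient (complete_quotient x i) j = complete_quotient x (i + j)"
  by (induction j) auto

lemma partial_quotient_complete_quotient:
  "partial_quotient (complete_quotient x i) j = partial_quotient x (i + j)"
  by (simp add: partial_quotient_def complete_quotient_complete_quotient)

lemma irrational_frac:
  fixes x :: real assumes "x \<notin> \<rat>" shows "frac x \<notin> \<rat>"
proof
  assume "frac x \<in> \<rat>"
  then have "frac x + of_int \<lfloor>x\<rfloor> \<in> \<rat>" by simp
  then show False using assms by (simp add: frac_def)
qed

lemma irrational_frac_bounds: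
  fixes x :: real assumes "x \<notin> \<rat>" shows "0 < frac x" "frac x < 1"
proof -
  have "frac x \<noteq> 0" using irrational_frac[OF assms] by (metis Rats_0)
  then show "0 < frac x" using frac_ge_0[of x] by linarith
qed (rule frac_lt_1)

lemma irrational_inverse:
  fixes x :: real assumes "x \<notin> \<rat>" shows "1 / x \<notin> \<rat>"
proof
  assume "1 / x \<in> \<rat>"
  then have "1 / (1 / x) \<in> \<rat>" by (rule Rats_divide[OF Rats_1])
  then show False using assms by simp
qed

lemma irrational_complete_quotient:
  "x \<notin> \<rat> \<Longrightarrow> complete_quotient x i \<notin> \<rat>"
  by (induction i) (simp_all add: irrational_inverse irrational_frac)

lemma complete_quotient_Suc_gt_1:
  assumes "x \<notin> \<rat>" shows "complete_quotient x (Suc i) > 1"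
  using irrational_frac_bounds[OF irrational_complete_quotient[OF assms, of i]] by simp

lemma complete_quotient_step:
  assumes "x \<notin> \<rat>"
  shows "complete_quotient x i = partial_quotient x i + 1 / complete_quotient x (Suc i)"
  by (simp add: partial_quotient_def frac_def)

lemma partial_quotient_Suc_ge_1:
  assumes "x \<notin> \<rat>" shows "partial_quotient x (Suc i) \<ge> 1"
  using complete_quotient_Suc_gt_1[OF assms, of i]
  unfolding partial_quotient_def by (metis floor_mono floor_one less_imp_le)

text \<open>Passing to the next complete quotient spreads two numbers with the same integer part apart.
  This expansion is what makes a continued fraction determine its value, and later what separates
  a number from its conjugate.\<close>

lemma same_floor_difference:
  fixes u v a s t :: real
  assumes "u = a + 1 / s" "v = a + 1 / t" "s > 1" "t > 1"
  shows "\<bar>s - t\<bar> = \<bar>u - v\<bar> * (s * t)"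
proof -
  have "u - v = 1 / s - 1 / t" using assms by simp
  also have "\<dots> = (t - s) / (s * t)" using assms by (simp add: diff_frac_eq)
  finally have "u - v = (t - s) / (s * t)" .
  then have "s - t = - (u - v) * (s * t)" using assms by simp
  then show ?thesis using assms by (simp add: abs_mult)
qed

lemma irrational_eqI_partial_quotients:
  assumes x: "x \<notin> \<rat>" and y: "y \<notin> \<rat>"
    and eq: "\<And>i. partial_quotient x i = partial_quotient y i"
  shows "x = y"
proof (rule ccontr)
  assume "x \<noteq> y"
  define u where "u = complete_quotient x"
  define v where "v = complete_quotient y"
  define d where "d i = \<bar>u i - v i\<bar>" for i
  have step: "d (Suc i) = d i * (u (Suc i) * v (Suc i))" for i
    unfolding d_def u_def v_def
    by (rule same_floor_difference[OF complete_quotient_step[OF x] _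
          complete_quotient_Suc_gt_1[OF x] complete_quotient_Suc_gt_1[OF y]])
      (simp add: eq complete_quotient_step[OF y, of i] del: complete_quotient.simps)
  \<comment> \<open>A single step may expand by a factor close to 1, but two steps expand by at least 4.\<close>
  have uu: "u (Suc i) * u (Suc (Suc i)) > 2" if "z = x \<or> z = y" "u = complete_quotient z" for u z i
  proof -
    have z: "z \<notin> \<rat>" using that x y by auto
    have g: "u (Suc (Suc i)) > 1" "u (Suc i) > 1"
      unfolding that(2) by (rule complete_quotient_Suc_gt_1[OF z])+
    have st: "u (Suc i) = partial_quotient z (Suc i) + 1 / u (Suc (Suc i))"
      unfolding that(2) by (rule complete_quotient_step[OF z])
    have "u (Suc i) * u (Suc (Suc i)) = partial_quotient z (Suc i) * u (Suc (Suc i)) + 1"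
      using st g by (simp add: algebra_simps)
    moreover have "partial_quotient z (Suc i) * u (Suc (Suc i)) \<ge> 1 * u (Suc (Suc i))"
      by (rule mult_right_mono) (use partial_quotient_Suc_ge_1[OF z] g in auto)
    ultimately show ?thesis using g by linarith
  qed
  have d2: "d (Suc (Suc (Suc i))) \<ge> 4 * d (Suc i)" for i
  proof -
    have "(u (Suc (Suc i)) * u (Suc (Suc (Suc i)))) * (v (Suc (Suc i)) * v (Suc (Suc (Suc i)))) \<ge> 2 * 2"
      by (rule mult_mono) (use uu[of x u "Suc i"] uu[of y v "Suc i"] in \<open>auto simp: u_def v_def\<close>)
    then have "d (Suc i) * ((u (Suc (Suc i)) * u (Suc (Suc (Suc i)))) * (v (Suc (Suc i)) * v (Suc (Suc (Suc i))))) \<ge> d (Suc i) * 4"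
      by (intro mult_left_mono) (auto simp: d_def)
    then show ?thesis by (simp add: step mult_ac)
  qed
  have grow: "d (Suc (2 * i)) \<ge> 4 ^ i * d 1" for i
  proof (induction i)
    case (Suc i)
    then show ?case using d2[of "2 * i"] by simp
  qed simp
  have u1: "u 1 > 1" "v 1 > 1"
    using complete_quotient_Suc_gt_1[OF x, of 0] complete_quotient_Suc_gt_1[OF y, of 0]
    by (auto simp: u_def v_def)
  have "d 1 > 0"
    using step[of 0] \<open>x \<noteq> y\<close> u1 by (simp add: d_def u_def v_def del: complete_quotient.simps(2))
  moreover have "d i < 1" for i
  proof -
    have "\<lfloor>u i\<rfloor> = \<lfloor>v i\<rfloor>" using eq[of i] by (simp add: partial_quotient_def u_def v_def)
    then show ?thesis unfolding d_def by linarith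
  qed
  moreover obtain i where "1 / d 1 < 4 ^ i"
    using real_arch_pow[of 4 "1 / d 1"] by auto
  ultimately show False using grow[of i]
    by (smt (verit) divide_less_eq)
qed

section \<open>Moebius equivalence of irrational numbers\<close>

text \<open>The determinant \<open>e\<close> is kept as a parameter because the sign of the matrix carries the
  parity of the period and separates conjugation from adjunction.\<close>

definition moebius_equiv :: "int \<Rightarrow> real \<Rightarrow> real \<Rightarrow> bool" where
  "moebius_equiv e x y \<longleftrightarrow>
     (\<exists>a b c d :: int. a * d - b * c = e \<and> y = (of_int a * x + of_int b) / (of_int c * x + of_int d))"

lemma irrational_linear_eq_0:
  fixes x :: real and c d :: int
  assumes "x \<notin> \<rat>" shows "c * x + d = 0 \<longleftrightarrow> c = 0 \<and> d = 0"
proof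
  assume *: "c * x + d = 0"
  have "c = 0"
  proof (rule ccontr)
    assume "c \<noteq> 0"
    with * have "x = - of_int d / of_int c" by (simp add: field_simps)
    then show False using assms by auto
  qed
  then show "c = 0 \<and> d = 0" using * by simp
qed auto

lemma moebius_equiv_irrational:
  assumes "moebius_equiv e x y" "x \<notin> \<rat>" "e \<noteq> 0" shows "y \<notin> \<rat>"
proof
  assume "y \<in> \<rat>"
  obtain a b c d :: int where *: "a * d - b * c = e" "y = (a * x + b) / (c * x + d)"
    using assms(1) by (auto simp: moebius_equiv_def)
  have nz: "c * x + d \<noteq> 0" using irrational_linear_eq_0[OF assms(2)] * assms(3) by auto
  obtain p q :: int where q: "q \<noteq> 0" "y = p / q"
    using \<open>y \<in> \<rat>\<close> by (metis Rats_cases' of_int_0_less_iff less_irrefl of_int_0)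
  have "(q * a - p * c :: int) * x + (q * b - p * d :: int) = 0"
    using * nz q by (simp add: field_simps)
  then have "q * a - p * c = 0 \<and> q * b - p * d = 0"
    by (rule irrational_linear_eq_0[OF assms(2), THEN iffD1])
  then have "q * a = p * c" "q * b = p * d" by auto
  then have "q * (a * d - b * c) = 0" by algebra
  then show False using * q assms(3) by auto
qed

lemma moebius_equiv_refl: "moebius_equiv 1 x x"
  unfolding moebius_equiv_def by (rule exI[of _ 1], rule exI[of _ 0], rule exI[of _ 0], rule exI[of _ 1]) simp

lemma moebius_equiv_sym:
  assumes "moebius_equiv e x y" "x \<notin> \<rat>" "e \<noteq> 0" shows "moebius_equiv e y x"
proof -
  obtain a b c d :: int where *: "a * d - b * c = e" "y = (a * x + b) / (c * x + d)"
    using assms(1) by (auto simp: moebius_equiv_def)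
  have nz: "c * x + d \<noteq> 0" using irrational_linear_eq_0[OF assms(2)] * assms(3) by auto
  have y: "y \<notin> \<rat>" by (rule moebius_equiv_irrational[OF assms])
  have nz2: "(-c) * y + a \<noteq> 0" using irrational_linear_eq_0[OF y, of "-c" a] * assms(3) by auto
  have "y * (c * x + d) = a * x + b" using * nz by simp
  then have "x * ((-c) * y + a) = d * y + (-b)" by (simp add: algebra_simps)
  then have "x = (d * y + (-b)) / ((-c) * y + a)" using nz2 by (simp add: field_simps)
  then show ?thesis unfolding moebius_equiv_def using *
    by (intro exI[of _ d] exI[of _ "-b"] exI[of _ "-c"] exI[of _ a]) (auto simp: algebra_simps)
qed

lemma moebius_equiv_trans:
  assumes "moebius_equiv e x y" "moebius_equiv f y z" "x \<notin> \<rat>" "e \<noteq> 0" "f \<noteq> 0"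
  shows "moebius_equiv (e * f) x z"
proof -
  obtain a b c d :: int where *: "a * d - b * c = e" "y = (a * x + b) / (c * x + d)"
    using assms(1) by (auto simp: moebius_equiv_def)
  obtain a' b' c' d' :: int where **: "a' * d' - b' * c' = f" "z = (a' * y + b') / (c' * y + d')"
    using assms(2) by (auto simp: moebius_equiv_def)
  have nz: "c * x + d \<noteq> 0" using irrational_linear_eq_0[OF assms(3)] * assms by auto
  have y: "y \<notin> \<rat>" by (rule moebius_equiv_irrational[OF assms(1,3,4)])
  have nz2: "c' * y + d' \<noteq> 0" using irrational_linear_eq_0[OF y] ** assms by auto
  have yE: "y * (c * x + d) = a * x + b" using nz * by simp
  have "z = ((a' * y + b') * (c * x + d)) / ((c' * y + d') * (c * x + d))"
    using nz nz2 ** by simp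
  also have "(a' * y + b') * (c * x + d) = (a' * a + b' * c) * x + (a' * b + b' * d)"
    using arg_cong[OF yE, of "\<lambda>t. a' * t"] by (simp add: algebra_simps)
  also have "(c' * y + d') * (c * x + d) = (c' * a + d' * c) * x + (c' * b + d' * d)"
    using arg_cong[OF yE, of "\<lambda>t. c' * t"] by (simp add: algebra_simps)
  finally have "z = ((a' * a + b' * c :: int) * x + (a' * b + b' * d :: int)) / ((c' * a + d' * c :: int) * x + (c' * b + d' * d :: int))"
    by simp
  moreover have "(a' * a + b' * c) * (c' * b + d' * d) - (a' * b + b' * d) * (c' * a + d' * c) = e * f"
    unfolding *(1)[symmetric] **(1)[symmetric] by (simp add: algebra_simps)
  ultimately show ?thesis unfolding moebius_equiv_def by blast
qed

lemma moebius_equiv_uminus: "moebius_equiv (-1) x (- x)"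
  unfolding moebius_equiv_def
  by (rule exI[of _ "-1"], rule exI[of _ 0], rule exI[of _ 0], rule exI[of _ 1]) simp

lemma moebius_equiv_shifted_inverse:
  fixes a :: int shows "moebius_equiv (-1) x (1 / (x - a))"
  unfolding moebius_equiv_def
  by (rule exI[of _ 0], rule exI[of _ 1], rule exI[of _ 1], rule exI[of _ "-a"]) simp

lemma moebius_equiv_negative_inverse: "moebius_equiv 1 x (- 1 / x)"
  unfolding moebius_equiv_def
  by (rule exI[of _ 0], rule exI[of _ "-1"], rule exI[of _ 1], rule exI[of _ 0]) simp

lemma moebius_equiv_complete_quotient:
  assumes "x \<notin> \<rat>" shows "moebius_equiv ((-1) ^ i) x (complete_quotient x i)"
proof (induction i)
  case 0 then show ?case by (simp add: moebius_equiv_refl)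
next
  case (Suc i)
  have "moebius_equiv (-1) (complete_quotient x i) (complete_quotient x (Suc i))"
    using moebius_equiv_shifted_inverse by (simp add: frac_def)
  from moebius_equiv_trans[OF Suc this assms] show ?case by simp
qed

section \<open>Serret's theorem with parity\<close>

definition common_tail :: "int \<Rightarrow> real \<Rightarrow> real \<Rightarrow> bool" where
  "common_tail e x y \<longleftrightarrow>
     (\<exists>i j. complete_quotient x i = complete_quotient y j \<and> (-1) ^ (i + j) = e)"

lemma common_tailI:
  "complete_quotient x i = complete_quotient y j \<Longrightarrow> (-1) ^ (i + j) = e \<Longrightarrow> common_tail e x y"
  by (auto simp: common_tail_def)

lemma common_tail_sym: "common_tail e x y \<Longrightarrow> common_tail e y x"
  unfolding common_tail_def by (metis add.commute)

text \<open>If \<open>x\<close> meets \<open>y\<close> at indices \<open>i, j\<close> and \<open>y\<close> meets \<open>z\<close> at \<open>k, l\<close>, moving \<open>k\<close> steps along the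
  first tail and \<open>j\<close> steps along the second leads to the same complete quotient, that of \<open>y\<close> at
  index \<open>j + k\<close>. The indices reached, \<open>i + k\<close> and \<open>l + j\<close>, add up to the sum of all four, so the
  signs multiply.\<close>

lemma common_tail_trans:
  assumes "common_tail e x y" "common_tail f y z" shows "common_tail (e * f) x z"
proof -
  obtain i j where ij: "complete_quotient x i = complete_quotient y j" "(-1) ^ (i + j) = e"
    using assms(1) by (auto simp: common_tail_def)
  obtain k l where kl: "complete_quotient y k = complete_quotient z l" "(-1) ^ (k + l) = f"
    using assms(2) by (auto simp: common_tail_def)
  have "complete_quotient x (i + k) = complete_quotient z (l + j)"
    by (metis ij(1) kl(1) complete_quotient_complete_quotient add.commute)
  then show ?thesis
    by (rule common_tailI) (use ij kl in \<open>simp add: power_add mult_ac flip: ij(2) kl(2)\<close>)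
qed

lemma common_tail_add_int: "common_tail 1 x (x + of_int b)"
  by (rule common_tailI[of _ 1 _ 1]) (simp_all add: frac_def)

text \<open>The rule is \<open>-[a; b, c, \<dots>] = [-a - 1; 1, b - 1, c, \<dots>]\<close> for \<open>b > 1\<close>: the
  expansions agree from index 2 of one and index 3 of the other. The case \<open>b = 1\<close> is the same
  rule read from right to left. The two cases are told apart by comparing the fractional part
  with \<open>1 / 2\<close>.\<close>

lemma common_tail_uminus:
  assumes x: "x \<notin> \<rat>" shows "common_tail (-1) x (- x)"
proof -
  have main: "common_tail (-1) z (- z)" if z: "z \<notin> \<rat>" "frac z < 1 / 2" for z
  proof -
    define t where "t = frac z"
    have t: "0 < t" "t < 1 / 2" using irrational_frac_bounds[OF z(1)] z(2) by (auto simp: t_def)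
    have "z \<notin> \<int>" using z(1) by (auto elim: Ints_cases)
    then have "frac (- z) = 1 - t" by (simp add: frac_neg t_def)
    then have 1: "complete_quotient (- z) 1 = 1 / (1 - t)" by simp
    have "\<lfloor>1 / (1 - t)\<rfloor> = 1" using t by (simp add: floor_eq_iff field_simps)
    then have "frac (1 / (1 - t)) = 1 / (1 - t) - 1" by (simp add: frac_def)
    also have "\<dots> = t / (1 - t)" using t by (simp add: field_simps)
    finally have 2: "complete_quotient (- z) 2 = (1 - t) / t"
      using 1 by (simp add: numeral_2_eq_2)
    also have "\<dots> = 1 / t - 1" using t by (simp add: field_simps)
    finally have 2: "complete_quotient (- z) 2 = 1 / t - 1" .
    have "frac (1 / t - 1) = frac (1 / t)" by (simp add: frac_def)
    with 2 have "complete_quotient (- z) 3 = complete_quotient z 2"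
      by (simp add: numeral_3_eq_3 numeral_2_eq_2 t_def)
    then show ?thesis by (intro common_tailI[of _ 2 _ 3]) auto
  qed
  have "1 / 2 \<in> (\<rat> :: real set)" by (intro Rats_divide) auto
  then have "frac x \<noteq> 1 / 2" using irrational_frac[OF x] by metis
  then consider "frac x < 1 / 2" | "frac x > 1 / 2" by linarith
  then show ?thesis
  proof cases
    case 1 then show ?thesis using main x by blast
  next
    case 2
    have "x \<notin> \<int>" using x by (auto elim: Ints_cases)
    then have "frac (- x) < 1 / 2" using 2 by (simp add: frac_neg)
    moreover have "- x \<notin> \<rat>" using x by (metis Rats_minus_iff)
    ultimately have "common_tail (-1) (- x) (- (- x))" by (intro main) auto
    then show ?thesis by (simp add: common_tail_sym)
  qed
qed

lemma common_tail_inverse: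
  assumes x: "x \<notin> \<rat>" shows "common_tail (-1) x (1 / x)"
proof -
  have small: "common_tail (-1) z (1 / z)" if "0 < z" "z < 1" for z
    by (rule common_tailI[of _ 1 _ 0]) (use that in \<open>auto simp: frac_eq\<close>)
  have pos: "common_tail (-1) z (1 / z)" if z: "z \<notin> \<rat>" "0 < z" for z
  proof (cases "z < 1")
    case False
    then have "z > 1" using z(1) by (cases "z = 1") auto
    then have "common_tail (-1) (1 / z) (1 / (1 / z))" by (intro small) auto
    then show ?thesis by (simp add: common_tail_sym)
  qed (use small z in auto)
  show ?thesis
  proof (cases "x > 0")
    case False
    then have "x < 0" using x by (cases "x = 0") auto
    then have 1: "common_tail (-1) (- x) (1 / (- x))" using x by (intro pos) auto
    have 2: "common_tail (-1) (1 / (- x)) (- (1 / (- x)))"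
      using irrational_inverse[of "- x"] x by (intro common_tail_uminus) auto
    show ?thesis
      using common_tail_trans[OF common_tail_trans[OF common_tail_uminus[OF x] 1] 2] by simp
  qed (use pos x in auto)
qed

text \<open>Euclid's algorithm on the lower left entry \<open>c\<close> writes the matrix as a product of translations,
  the inversion \<open>y \<mapsto> 1 / y\<close> and a sign change. For each of these generators the
  common tail is explicit, and the parities compose like determinants.\<close>

lemma moebius_equiv_imp_common_tail:
  assumes x: "x \<notin> \<rat>" and e: "e = 1 \<or> e = -1" and equiv: "moebius_equiv e x y"
  shows "common_tail e x y"
proof -
  have "common_tail e x y"
    if "a * d - b * c = e" "e = 1 \<or> e = -1" "y = (a * x + b) / (c * x + d)"
    for a b c d e :: int and y
    using that
  proof (induction "nat \<bar>c\<bar>" arbitrary: a b c d e y rule: less_induct)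
    case less
    show ?case
    proof (cases "c = 0")
      case True
      then have ad: "a * d = e" using less.prems by simp
      then have "\<bar>d * a\<bar> = 1" using less.prems(2) by (auto simp: mult.commute)
      then have d: "d = 1 \<or> d = -1" using abs_zmult_eq_1[of d a] by linarith
      then have y: "y = e * x + of_int (d * b)"
        using True less.prems(3) d ad by auto
      have "common_tail e x (e * x)"
        using less.prems(2) common_tail_uminus[OF x] common_tail_add_int[of x 0] by auto
      from common_tail_trans[OF this common_tail_add_int, of "d * b"] show ?thesis
        by (simp add: y)
    next
      case False
      define q where "q = a div c"
      define r where "r = a mod c"
      have a: "a = q * c + r" by (simp add: q_def r_def)
      have r: "nat \<bar>r\<bar> < nat \<bar>c\<bar>" using False by (simp add: r_def abs_mod_less)
      have y: "y \<notin> \<rat>"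
        by (rule moebius_equiv_irrational[of e x]) (use less.prems x in \<open>auto simp: moebius_equiv_def\<close>)
      then have yq: "y - q \<notin> \<rat>" by (metis Rats_add Rats_of_int diff_add_cancel)
      have nz: "c * x + d \<noteq> 0" using irrational_linear_eq_0[OF x] False by auto
      have "y - q = (r * x + (b - q * d)) / (c * x + d)"
        using nz less.prems(3) by (simp add: a field_simps)
      then have "1 / (y - q) = (c * x + d) / (r * x + (b - q * d :: int))" by simp
      moreover have "c * (b - q * d) - d * r = - e"
        using less.prems(1) unfolding a by (simp add: algebra_simps)
      ultimately have "common_tail (- e) x (1 / (y - q))"
        using less.prems(2) by (intro less.hyps[OF r]) auto
      moreover have "common_tail (-1) (1 / (y - q)) (y - q)"
        by (rule common_tail_sym[OF common_tail_inverse[OF yq]])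
      moreover have "common_tail 1 (y - q) y"
        using common_tail_add_int[of "y - q" q] by simp
      ultimately have "common_tail (- e * -1 * 1) x y"
        by (blast intro: common_tail_trans)
      then show ?thesis by simp
    qed
  qed
  then show ?thesis using equiv e by (auto simp: moebius_equiv_def)
qed

lemma common_tail_imp_moebius_equiv:
  assumes "x \<notin> \<rat>" "y \<notin> \<rat>" "common_tail e x y"
  shows "moebius_equiv e x y"
proof -
  obtain i j where ij: "complete_quotient x i = complete_quotient y j" "(-1) ^ (i + j) = e"
    using assms(3) by (auto simp: common_tail_def)
  have "moebius_equiv ((-1) ^ i) x (complete_quotient y j)"
    using moebius_equiv_complete_quotient[OF assms(1), of i] ij by simp
  moreover have "moebius_equiv ((-1) ^ j) (complete_quotient y j) y"
    by (rule moebius_equiv_sym[OF moebius_equiv_complete_quotient[OF assms(2)] assms(2)]) simp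
  ultimately have "moebius_equiv ((-1) ^ i * (-1) ^ j) x y"
    by (rule moebius_equiv_trans[OF _ _ assms(1)]) auto
  then show ?thesis using ij by (simp add: power_add)
qed

section \<open>Periods of eventually periodic sequences\<close>

definition eventual_period :: "(nat \<Rightarrow> 'a) \<Rightarrow> nat \<Rightarrow> bool" where
  "eventual_period a p \<longleftrightarrow> p > 0 \<and> (\<exists>N. \<forall>i\<ge>N. a (i + p) = a i)"

lemma periodic_add_mult:
  fixes a :: "nat \<Rightarrow> 'a"
  assumes "\<And>i. i \<ge> N \<Longrightarrow> a (i + p) = a i" "i \<ge> N"
  shows "a (i + k * p) = a i"
proof (induction k)
  case (Suc k)
  have "a (i + k * p + p) = a (i + k * p)" using assms by simp
  then show ?case using Suc by (simp add: add_ac)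
qed simp

lemma repeating_block_imp_eventual_period:
  assumes "repeating_block a xs" shows "eventual_period a (length xs)"
proof -
  obtain N where N: "xs \<noteq> []" "\<And>i. a (N + i) = xs ! (i mod length xs)"
    using assms by (auto simp: repeating_block_def)
  have "a (i + length xs) = a i" if "i \<ge> N" for i
  proof -
    have "a (N + (i - N + length xs)) = a (N + (i - N))" by (simp only: N(2) mod_add_self2)
    moreover have "N + (i - N + length xs) = i + length xs" "N + (i - N) = i" using that by auto
    ultimately show ?thesis by simp
  qed
  then show ?thesis using N(1) by (auto simp: eventual_period_def)
qed

lemma eventual_period_imp_repeating_block:
  assumes "eventual_period a p" shows "\<exists>xs. length xs = p \<and> repeating_block a xs"
proof -
  obtain N where N: "p > 0" "\<And>i. i \<ge> N \<Longrightarrow> a (i + p) = a i"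
    using assms by (auto simp: eventual_period_def)
  define xs where "xs = map (\<lambda>i. a (N + i)) [0..<p]"
  have "a (N + i) = xs ! (i mod length xs)" for i
  proof -
    have "a (N + i mod p + (i div p) * p) = a (N + i mod p)"
      by (rule periodic_add_mult[of N a p, OF N(2)]) auto
    then show ?thesis using N(1) by (simp add: xs_def add.assoc)
  qed
  then show ?thesis using N(1) by (intro exI[of _ xs]) (auto simp: repeating_block_def xs_def)
qed

lemma minimal_blocks_ex_if_eventual_period:
  assumes "eventual_period a p" shows "\<exists>xs. xs \<in> minimal_blocks a"
proof -
  have "\<exists>xs. repeating_block a xs" using eventual_period_imp_repeating_block[OF assms] by auto
  then obtain xs where "repeating_block a xs" "\<And>ys. repeating_block a ys \<Longrightarrow> length xs \<le> length ys"
    by (metis ex_has_least_nat)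
  then show ?thesis by (auto simp: minimal_blocks_def)
qed

text \<open>The remainder of one period modulo another is again a period, so minimality forces it to
  vanish. Hence a single odd period already makes the minimal one odd.\<close>

lemma length_minimal_block_dvd_eventual_period:
  assumes "xs \<in> minimal_blocks a" "eventual_period a q" shows "length xs dvd q"
proof (rule ccontr)
  define p where "p = length xs"
  assume "\<not> length xs dvd q"
  then have r: "q mod p > 0" by (simp add: p_def dvd_eq_mod_eq_0)
  have "eventual_period a p"
    using assms(1) repeating_block_imp_eventual_period by (auto simp: minimal_blocks_def p_def)
  then obtain N where N: "p > 0" "\<And>i. i \<ge> N \<Longrightarrow> a (i + p) = a i"
    by (auto simp: eventual_period_def)
  obtain M where M: "\<And>i. i \<ge> M \<Longrightarrow> a (i + q) = a i"
    using assms(2) by (auto simp: eventual_period_def)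
  have "a (i + q mod p) = a i" if "i \<ge> max M N" for i
  proof -
    have "a (i + q mod p) = a (i + q mod p + (q div p) * p)"
      by (rule periodic_add_mult[of N a p, OF N(2), symmetric]) (use that in auto)
    also have "\<dots> = a i" using M that by (simp add: add.assoc)
    finally show ?thesis .
  qed
  then have "eventual_period a (q mod p)" unfolding eventual_period_def using r by blast
  then obtain ys where "length ys = q mod p" "repeating_block a ys"
    using eventual_period_imp_repeating_block by metis
  then have "p \<le> q mod p" using assms(1) by (auto simp: minimal_blocks_def p_def)
  then show False using N(1) by (meson mod_less_divisor not_le)
qed

lemma complete_quotient_cong_shift:
  assumes x: "x \<notin> \<rat>" and y: "y \<notin> \<rat>"
    and "\<And>t. partial_quotient x (i + t) = partial_quotient y (j + t)"
  shows "complete_quotient x i = complete_quotient y j"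
  by (rule irrational_eqI_partial_quotients)
    (use assms in \<open>auto simp: irrational_complete_quotient partial_quotient_complete_quotient\<close>)

lemma repeating_block_complete_quotient:
  assumes x: "x \<notin> \<rat>" and "repeating_block (partial_quotient x) xs"
  obtains N where "\<And>i. partial_quotient x (N + i) = xs ! (i mod length xs)"
    and "complete_quotient x (N + length xs) = complete_quotient x N"
proof -
  obtain N where N: "\<And>i. partial_quotient x (N + i) = xs ! (i mod length xs)"
    using assms by (auto simp: repeating_block_def)
  moreover have "complete_quotient x (N + length xs) = complete_quotient x N"
    by (rule complete_quotient_cong_shift[OF x x]) (use N in \<open>simp add: add.assoc\<close>)
  ultimately show ?thesis using that by blast
qed

text \<open>A coincidence of complete quotients at indices of different parity yields a period of odd
  length and, conversely, an odd block yields such a coincidence. This is Serret's theorem for the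
  pair \<open>x, x\<close>.\<close>

lemma odd_period_iff:
  assumes x: "x \<notin> \<rat>"
  shows "odd_period (minimal_blocks (partial_quotient x)) \<longleftrightarrow> moebius_equiv (-1) x x"
proof
  assume "odd_period (minimal_blocks (partial_quotient x))"
  then obtain xs where xs: "repeating_block (partial_quotient x) xs" "odd (length xs)"
    by (auto simp: odd_period_def minimal_blocks_def)
  obtain N where "complete_quotient x (N + length xs) = complete_quotient x N"
    using repeating_block_complete_quotient[OF x xs(1)] by blast
  then have "common_tail (-1) x x"
    by (rule common_tailI) (use xs(2) in simp)
  then show "moebius_equiv (-1) x x" by (rule common_tail_imp_moebius_equiv[OF x x])
next
  assume "moebius_equiv (-1) x x"
  then have "common_tail (-1) x x" by (intro moebius_equiv_imp_common_tail[OF x]) auto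
  then obtain i j where ij: "complete_quotient x i = complete_quotient x j" "(-1 :: int) ^ (i + j) = -1"
    by (auto simp: common_tail_def)
  have odd: "odd (i + j)"
  proof
    assume "even (i + j)"
    then show False using ij(2) by simp
  qed
  have "\<exists>k l. k < l \<and> odd (k + l) \<and> complete_quotient x l = complete_quotient x k"
  proof (cases i j rule: linorder_cases)
    case less then show ?thesis using odd ij by (intro exI[of _ i] exI[of _ j]) auto
  next
    case equal then show ?thesis using odd by simp
  next
    case greater then show ?thesis using odd ij by (intro exI[of _ j] exI[of _ i]) (auto simp: add.commute)
  qed
  then obtain k l where kl: "k < l" "odd (k + l)" "complete_quotient x l = complete_quotient x k" by blast
  have "partial_quotient x (t + (l - k)) = partial_quotient x t" if "t \<ge> k" for t
  proof -
    have "partial_quotient x (l + (t - k)) = partial_quotient x (k + (t - k))"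
      using kl(3) by (metis partial_quotient_complete_quotient)
    moreover have "l + (t - k) = t + (l - k)" using that kl(1) by simp
    ultimately show ?thesis using that by simp
  qed
  then have per: "eventual_period (partial_quotient x) (l - k)"
    using kl(1) by (auto simp: eventual_period_def)
  then obtain xs where xs: "xs \<in> minimal_blocks (partial_quotient x)"
    using minimal_blocks_ex_if_eventual_period by blast
  have "length xs dvd l - k" by (rule length_minimal_block_dvd_eventual_period[OF xs per])
  moreover have "odd (l - k)" using kl by auto
  ultimately have "odd (length xs)" using dvd_trans by blast
  then show "odd_period (minimal_blocks (partial_quotient x))"
    using xs by (auto simp: odd_period_def)
qed

section \<open>Galois' theorem on the conjugate expansion\<close>

text \<open>Irrationality of \<open>x\<close> together with a rational sum and product says that \<open>x\<close> and \<open>y\<close> are the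
  two roots of an irreducible rational quadratic polynomial. In this form the relation is visibly
  stable under \<open>x \<mapsto> 1 / (x - a)\<close>, and all complete quotients of \<open>x\<close> can be treated alike.\<close>

definition rational_conjugates :: "real \<Rightarrow> real \<Rightarrow> bool" where
  "rational_conjugates x y \<longleftrightarrow> x \<notin> \<rat> \<and> x + y \<in> \<rat> \<and> x * y \<in> \<rat>"

lemma rational_conjugates_irrational:
  assumes "rational_conjugates x y" shows "x \<notin> \<rat>" "y \<notin> \<rat>"
proof -
  show x: "x \<notin> \<rat>" using assms by (simp add: rational_conjugates_def)
  show "y \<notin> \<rat>"
  proof
    assume "y \<in> \<rat>"
    then have "(x + y) - y \<in> \<rat>" using assms unfolding rational_conjugates_def by (intro Rats_diff) auto
    then show False using x by simp
  qed
qed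

lemma rational_conjugates_neq:
  assumes "rational_conjugates x y" shows "x \<noteq> y"
proof
  assume "x = y"
  then have "(x + y) / 2 \<in> \<rat>" using assms unfolding rational_conjugates_def by (intro Rats_divide) auto
  then show False using \<open>x = y\<close> rational_conjugates_irrational[OF assms] by simp
qed

text \<open>Two candidates \<open>y\<close> and \<open>z\<close> would give rational \<open>y - z\<close> and \<open>x (y - z)\<close>, hence rational \<open>x\<close>.
  So whatever repeats in the expansion of \<open>x\<close> repeats for the conjugates.\<close>

lemma rational_conjugates_unique:
  assumes "rational_conjugates x y" "rational_conjugates x z" shows "y = z"
proof (rule ccontr)
  assume "y \<noteq> z"
  have "(x + y) - (x + z) \<in> \<rat>" "x * y - x * z \<in> \<rat>"
    using assms unfolding rational_conjugates_def by (blast intro: Rats_diff)+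
  then have "(x * y - x * z) / ((x + y) - (x + z)) \<in> \<rat>" by (rule Rats_divide[rotated])
  moreover have "(x * y - x * z) / ((x + y) - (x + z)) = x"
    using \<open>y \<noteq> z\<close> by (simp add: field_simps)
  ultimately show False using rational_conjugates_irrational[OF assms(1)] by simp
qed

lemma rational_conjugates_shifted_inverse:
  fixes a :: int
  assumes "rational_conjugates x y" shows "rational_conjugates (1 / (x - a)) (1 / (y - a))"
proof -
  note irr = rational_conjugates_irrational[OF assms]
  have xa: "x - a \<notin> \<rat>" "y - a \<notin> \<rat>" using irr by (metis Rats_add Rats_of_int diff_add_cancel)+
  then have nz: "x - a \<noteq> 0" "y - a \<noteq> 0" by (metis Rats_0)+
  have s: "x + y \<in> \<rat>" "x * y \<in> \<rat>" using assms by (auto simp: rational_conjugates_def)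
  have "x * y - a * (x + y) + a * a \<in> \<rat>"
    by (intro Rats_add Rats_diff Rats_mult Rats_of_int s)
  then have p: "(x - a) * (y - a) \<in> \<rat>" by (simp add: algebra_simps)
  have "((x + y) - 2 * a) / ((x - a) * (y - a)) \<in> \<rat>"
    by (intro Rats_divide Rats_diff Rats_mult s p) auto
  moreover have "1 / (x - a) + 1 / (y - a) = ((x + y) - 2 * a) / ((x - a) * (y - a))"
    using nz by (simp add: add_frac_eq)
  moreover have "1 / ((x - a) * (y - a)) \<in> \<rat>" by (rule Rats_divide[OF Rats_1 p])
  ultimately show ?thesis
    using irrational_inverse[OF xa(1)] by (simp add: rational_conjugates_def)
qed

text \<open>The conjugate of each complete quotient of \<open>x\<close>, where \<open>y\<close> is the conjugate of \<open>x\<close>. The partial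
  quotients subtracted are those of \<open>x\<close>, so in general this is not the expansion of \<open>y\<close>.\<close>

primrec conjugate_quotient :: "real \<Rightarrow> real \<Rightarrow> nat \<Rightarrow> real" where
  "conjugate_quotient x y 0 = y"
| "conjugate_quotient x y (Suc i) = 1 / (conjugate_quotient x y i - partial_quotient x i)"

lemma rational_conjugates_quotients:
  assumes "rational_conjugates x y"
  shows "rational_conjugates (complete_quotient x i) (conjugate_quotient x y i)"
proof (induction i)
  case (Suc i)
  then show ?case
    using rational_conjugates_shifted_inverse[OF Suc, of "partial_quotient x i"]
    by (simp add: frac_def partial_quotient_def)
qed (use assms in simp)

lemma conjugate_quotient_step:
  assumes "rational_conjugates x y"
  shows "conjugate_quotient x y i = partial_quotient x i + 1 / conjugate_quotient x y (Suc i)"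
  by simp

lemma moebius_equiv_conjugate_quotient:
  assumes "rational_conjugates x y"
  shows "moebius_equiv ((-1) ^ i) y (conjugate_quotient x y i)"
proof (induction i)
  case 0 then show ?case by (simp add: moebius_equiv_refl)
next
  case (Suc i)
  have "moebius_equiv (-1) (conjugate_quotient x y i) (conjugate_quotient x y (Suc i))"
    using moebius_equiv_shifted_inverse by simp
  from moebius_equiv_trans[OF Suc this rational_conjugates_irrational(2)[OF assms]]
  show ?case by simp
qed

context
  fixes x y :: real and N p :: nat
  assumes conj: "rational_conjugates x y"
    and p: "p > 0"
    and periodic: "complete_quotient x (N + p) = complete_quotient x N"
begin

lemma conjugate_quotient_periodic:
  assumes "i \<ge> N" shows "conjugate_quotient x y (i + k * p) = conjugate_quotient x y i"
proof (rule periodic_add_mult[OF _ assms])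
  fix i assume "i \<ge> N"
  have "complete_quotient x (i + p) = complete_quotient x i"
    using periodic \<open>i \<ge> N\<close>
    by (metis complete_quotient_complete_quotient add.assoc add.commute le_Suc_ex)
  then show "conjugate_quotient x y (i + p) = conjugate_quotient x y i"
    using rational_conjugates_quotients[OF conj] rational_conjugates_unique by metis
qed

text \<open>If no conjugate were negative from some index on, all of them would exceed 1 and have
  the same partial quotients as the complete quotients themselves. The distance between the two
  would then strictly increase at every step, contradicting periodicity.\<close>

lemma ex_conjugate_quotient_negative: "\<exists>i>N. conjugate_quotient x y i < 0"
proof (rule ccontr)
  assume "\<not> ?thesis"
  then have nonneg: "conjugate_quotient x y i \<ge> 0" if "i > N" for i using that by (meson not_less)
  have x: "x \<notin> \<rat>" using rational_conjugates_irrational[OF conj] by simp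
  define u where "u i = complete_quotient x (Suc N + i)" for i
  define v where "v i = conjugate_quotient x y (Suc N + i)" for i
  have v0: "v i > 0" for i
  proof -
    have "v i \<notin> \<rat>" unfolding v_def
      by (rule rational_conjugates_irrational(2)[OF rational_conjugates_quotients[OF conj]])
    then have "v i \<noteq> 0" by (metis Rats_0)
    then show ?thesis using nonneg[of "Suc N + i"] by (simp add: v_def del: conjugate_quotient.simps)
  qed
  have u1: "u i > 1" for i
    unfolding u_def add_Suc by (rule complete_quotient_Suc_gt_1[OF x])
  have us: "u i = partial_quotient x (Suc N + i) + 1 / u (Suc i)" for i
    unfolding u_def add_Suc_right by (rule complete_quotient_step[OF x])
  have vs: "v i = partial_quotient x (Suc N + i) + 1 / v (Suc i)" for i
    unfolding v_def add_Suc_right by (rule conjugate_quotient_step[OF conj])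
  have v1: "v i > 1" for i
  proof -
    have "partial_quotient x (Suc N + i) \<ge> 1" unfolding add_Suc by (rule partial_quotient_Suc_ge_1[OF x])
    then have "real_of_int (partial_quotient x (Suc N + i)) \<ge> 1" by linarith
    moreover have "1 / v (Suc i) > 0" using v0 by simp
    ultimately show ?thesis using vs[of i] by linarith
  qed
  define d where "d i = \<bar>u i - v i\<bar>" for i
  have d0: "d i > 0" for i
    using rational_conjugates_neq[OF rational_conjugates_quotients[OF conj]]
    by (simp add: d_def u_def v_def del: conjugate_quotient.simps complete_quotient.simps)
  have "d i < d (Suc i)" for i
  proof -
    have "d (Suc i) = d i * (u (Suc i) * v (Suc i))"
      unfolding d_def by (rule same_floor_difference[OF us vs u1 v1])
    moreover have "u (Suc i) * v (Suc i) > 1" using u1 v1 by (intro less_1_mult)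
    ultimately show ?thesis using d0[of i] by simp
  qed
  then have "d 0 < d p" using p by (rule lift_Suc_mono_less)
  moreover have "u p = u 0"
    unfolding u_def using periodic
    by (metis complete_quotient_complete_quotient add.assoc add.commute add_0_right add_Suc)
  moreover have "v p = v 0"
    unfolding v_def using conjugate_quotient_periodic[of "Suc N" 1] by (simp del: conjugate_quotient.simps)
  ultimately show False by (simp add: d_def)
qed

text \<open>Once a conjugate is negative, subtracting a partial quotient of at least 1 and inverting puts
  all later ones into \<open>(-1, 0)\<close>; periodicity carries this back to every index from \<open>N\<close> on.\<close>

lemma conjugate_quotient_bounds:
  assumes "i \<ge> N" shows "-1 < conjugate_quotient x y i" "conjugate_quotient x y i < 0"
proof -
  have x: "x \<notin> \<rat>" using rational_conjugates_irrational[OF conj] by simp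
  obtain j where j: "j > N" "conjugate_quotient x y j < 0" using ex_conjugate_quotient_negative by blast
  have step: "-1 < conjugate_quotient x y (Suc k) \<and> conjugate_quotient x y (Suc k) < 0"
    if "conjugate_quotient x y k < 0" "k > 0" for k
  proof -
    have "partial_quotient x k \<ge> 1" using partial_quotient_Suc_ge_1[OF x, of "k - 1"] that by simp
    then have "real_of_int (partial_quotient x k) \<ge> 1" by linarith
    then have "conjugate_quotient x y k - partial_quotient x k < -1" using that by linarith
    then show ?thesis by (simp add: divide_simps)
  qed
  have after: "-1 < conjugate_quotient x y (Suc (j + k)) \<and> conjugate_quotient x y (Suc (j + k)) < 0" for k
  proof (induction k)
    case 0 then show ?case using step[OF j(2)] j(1) by (simp del: conjugate_quotient.simps)
  next
    case (Suc k) then show ?case using step[of "Suc (j + k)"] by (simp del: conjugate_quotient.simps)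
  qed
  have "Suc j \<le> i + Suc j * p" using p
    by (metis le_add2 mult_le_mono2 nat_mult_1_right Suc_leI One_nat_def order_trans)
  then obtain k where "i + Suc j * p = Suc (j + k)" by (metis le_Suc_ex add_Suc)
  then have "conjugate_quotient x y i = conjugate_quotient x y (Suc (j + k))"
    using conjugate_quotient_periodic[OF assms] by metis
  then show "-1 < conjugate_quotient x y i" "conjugate_quotient x y i < 0" using after by auto
qed

text \<open>With \<open>w\<^sub>i = -1 / x\<^sub>i'\<close>, where \<open>x\<^sub>i'\<close> is the conjugate of the complete quotient
  \<open>x\<^sub>i = a\<^sub>i + 1 / x\<^bsub>i+1\<^esub>\<close>, conjugating this relation gives \<open>w\<^bsub>i+1\<^esub> = a\<^sub>i + 1 / w\<^sub>i\<close>. As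
  \<open>w\<^sub>i > 1\<close>, this is a continued fraction step, but it runs backwards through the indices.\<close>

lemma partial_quotient_reversed:
  assumes "i \<ge> N"
  shows "partial_quotient (- 1 / conjugate_quotient x y (i + Suc k)) k = partial_quotient x i"
proof -
  define w where "w i = - 1 / conjugate_quotient x y i" for i
  have w: "w j > 1" if "j \<ge> N" for j
    using conjugate_quotient_bounds[OF that] by (simp add: w_def field_simps)
  have step: "w (Suc j) = partial_quotient x j + 1 / w j" if "j \<ge> N" for j
    using conjugate_quotient_bounds[OF that] by (simp add: w_def)
  have fl: "\<lfloor>w (Suc j)\<rfloor> = partial_quotient x j" if "j \<ge> N" for j
    using step[OF that] w[OF that] by (simp add: floor_eq_iff)
  have fr: "1 / frac (w (Suc j)) = w j" if "j \<ge> N" for j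
    using step[OF that] fl[OF that] by (simp add: frac_def)
  have *: "complete_quotient (w (i + k)) k = w i" if "i \<ge> N" for i k
    using that
  proof (induction k arbitrary: i)
    case (Suc k)
    then have "complete_quotient (w (Suc i + k)) k = w (Suc i)" by (intro Suc.IH) simp
    moreover have "complete_quotient (w (i + Suc k)) (Suc k) = 1 / frac (complete_quotient (w (Suc i + k)) k)"
      by simp
    ultimately show ?case using fr[OF Suc.prems] by simp
  qed simp
  have "complete_quotient (w (Suc i + k)) k = w (Suc i)" using assms by (intro *) simp
  then show "partial_quotient (- 1 / conjugate_quotient x y (i + Suc k)) k = partial_quotient x i"
    using fl[OF assms] by (simp add: w_def partial_quotient_def del: conjugate_quotient.simps)
qed

lemma partial_quotient_conjugate_rev:
  assumes block: "\<And>i. partial_quotient x (N + i) = xs ! (i mod p)" "length xs = p"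
  shows "partial_quotient (- 1 / conjugate_quotient x y N) j = rev xs ! (j mod p)"
proof -
  \<comment> \<open>The expansion read backwards from index \<open>N\<close> would leave the periodic part; by periodicity it
    can start from \<open>N + (j + 1) p\<close> instead, which is far enough for \<open>j + 1\<close> steps.\<close>
  have j: "Suc j \<le> Suc j * p" using p by (cases p) auto
  define i where "i = Suc j * p - Suc j"
  have "conjugate_quotient x y N = conjugate_quotient x y (N + i + Suc j)"
    using conjugate_quotient_periodic[of N "Suc j"] le_add_diff_inverse2[OF j] by (simp add: i_def add.assoc del: conjugate_quotient.simps mult_Suc add_Suc add_Suc_right)
  then have "partial_quotient (- 1 / conjugate_quotient x y N) j = partial_quotient x (N + i)"
    using partial_quotient_reversed[of "N + i" j] by (simp del: conjugate_quotient.simps)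
  also have "\<dots> = xs ! (i mod p)" by (rule block)
  also have "i mod p = p - Suc (j mod p)"
  proof -
    have "i + (j + 1) = Suc j * p" using j by (simp add: i_def)
    then have "(i + (j mod p + 1)) mod p = 0"
      by (metis add.assoc mod_add_left_eq mod_add_right_eq mod_mult_self2_is_0)
    moreover have "j mod p < p" using p by simp
    ultimately have "p dvd i mod p + (j mod p + 1)" by (metis mod_add_left_eq mod_0_imp_dvd)
    moreover have "i mod p + (j mod p + 1) < 2 * p" "0 < i mod p + (j mod p + 1)"
      using p mod_less_divisor[OF p, of i] mod_less_divisor[OF p, of j] by linarith+
    ultimately obtain l where "i mod p + (j mod p + 1) = p * l" "p * l < p * 2" "p * l > 0"
      by (metis dvdE mult.commute)
    then have "i mod p + (j mod p + 1) = p" by (cases "l = 1") auto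
    then show ?thesis by simp
  qed
  also have "xs ! (p - Suc (j mod p)) = rev xs ! (j mod p)"
    using block(2) p by (simp add: rev_nth)
  finally show ?thesis .
qed

end

text \<open>The conjugate \<open>y\<close> is equivalent to a number \<open>w\<close> whose expansion repeats the
  reversed block of \<open>x\<close>. So \<open>x\<close> and \<open>y\<close> are equivalent iff \<open>x\<close> and \<open>w\<close> have a common tail, which
  means that the block and its reversal are rotations of each other. Either sign of
  the determinant can occur, since the indices at which the tails meet may have any parity.\<close>

lemma palindromic_period_iff:
  assumes conj: "rational_conjugates x y" and per: "minimal_blocks (partial_quotient x) \<noteq> {}"
  shows "palindromic_period (minimal_blocks (partial_quotient x)) \<longleftrightarrow>
    moebius_equiv 1 x y \<or> moebius_equiv (-1) x y"
proof -
  note irr = rational_conjugates_irrational[OF conj]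
  \<comment> \<open>Both directions compare a block of \<open>x\<close> with a number \<open>w\<close> equivalent to \<open>y\<close> whose expansion is
    purely periodic with the reversed block.\<close>
  have block_data: thesis
    if "xs \<in> minimal_blocks (partial_quotient x)"
      "\<And>N w e. length xs > 0 \<Longrightarrow> w \<notin> \<rat> \<Longrightarrow> e = 1 \<or> e = -1 \<Longrightarrow> moebius_equiv e y w \<Longrightarrow>
         (\<And>i. partial_quotient x (N + i) = xs ! (i mod length xs)) \<Longrightarrow>
         (\<And>i. partial_quotient w i = rev xs ! (i mod length xs)) \<Longrightarrow> thesis" for thesis xs
  proof -
    have block: "repeating_block (partial_quotient x) xs" using that(1) by (simp add: minimal_blocks_def)
    then have pos: "length xs > 0" by (simp add: repeating_block_def)
    obtain N where N: "\<And>i. partial_quotient x (N + i) = xs ! (i mod length xs)"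
      "complete_quotient x (N + length xs) = complete_quotient x N"
      using repeating_block_complete_quotient[OF irr(1) block] by blast
    have "conjugate_quotient x y N \<notin> \<rat>"
      by (rule rational_conjugates_irrational(2)[OF rational_conjugates_quotients[OF conj]])
    then have w: "- 1 / conjugate_quotient x y N \<notin> \<rat>" using irrational_inverse by fastforce
    have "moebius_equiv ((-1) ^ N * 1) y (- 1 / conjugate_quotient x y N)"
      by (rule moebius_equiv_trans[OF moebius_equiv_conjugate_quotient[OF conj] moebius_equiv_negative_inverse irr(2)]) auto
    moreover have "(-1 :: int) ^ N * 1 = 1 \<or> (-1 :: int) ^ N * 1 = -1" by (cases "even N") auto
    ultimately show thesis
      using that(2)[OF pos w _ _ N(1) partial_quotient_conjugate_rev[OF conj pos N(2) N(1) refl]] by blast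
  qed
  show ?thesis
  proof
    assume "palindromic_period (minimal_blocks (partial_quotient x))"
    then obtain xs r where xs: "xs \<in> minimal_blocks (partial_quotient x)" "rotate r xs = rev xs"
      by (auto simp: palindromic_period_def)
    show "moebius_equiv 1 x y \<or> moebius_equiv (-1) x y"
    proof (rule block_data[OF xs(1)])
      fix N w e
      assume pos: "length xs > 0" and w: "w \<notin> \<rat>" and e: "e = 1 \<or> e = -1" and eq: "moebius_equiv e y w"
        and a: "\<And>i. partial_quotient x (N + i) = xs ! (i mod length xs)"
        and b: "\<And>i. partial_quotient w i = rev xs ! (i mod length xs)"
      have "complete_quotient x (N + r) = complete_quotient w 0"
      proof (rule complete_quotient_cong_shift[OF irr(1) w])
        fix t
        have "partial_quotient w (0 + t) = rotate r xs ! (t mod length xs)" by (simp add: b xs(2))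
        also have "\<dots> = xs ! ((r + t) mod length xs)" using pos by (simp add: nth_rotate mod_add_right_eq)
        finally show "partial_quotient x (N + r + t) = partial_quotient w (0 + t)"
          by (simp add: a add.assoc)
      qed
      then have "common_tail ((-1) ^ (N + r + 0)) x w" by (rule common_tailI) (rule refl)
      then have "moebius_equiv ((-1) ^ (N + r + 0)) x w" by (rule common_tail_imp_moebius_equiv[OF irr(1) w])
      moreover have "moebius_equiv e w y" by (rule moebius_equiv_sym[OF eq irr(2)]) (use e in auto)
      ultimately have "moebius_equiv ((-1) ^ (N + r + 0) * e) x y"
        by (rule moebius_equiv_trans[OF _ _ irr(1)]) (use e in auto)
      then show ?thesis using e by (cases "even (N + r)") auto
    qed
  next
    assume "moebius_equiv 1 x y \<or> moebius_equiv (-1) x y"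
    then obtain f where f: "f = 1 \<or> f = -1" "moebius_equiv f x y" by blast
    obtain xs where xs: "xs \<in> minimal_blocks (partial_quotient x)" using per by blast
    show "palindromic_period (minimal_blocks (partial_quotient x))"
    proof (rule block_data[OF xs])
      fix N w e
      assume pos: "length xs > 0" and w: "w \<notin> \<rat>" and e: "e = 1 \<or> e = -1" and eq: "moebius_equiv e y w"
        and a: "\<And>i. partial_quotient x (N + i) = xs ! (i mod length xs)"
        and b: "\<And>i. partial_quotient w i = rev xs ! (i mod length xs)"
      define p where "p = length xs"
      have "moebius_equiv (f * e) x w"
        by (rule moebius_equiv_trans[OF f(2) eq irr(1)]) (use e f in auto)
      then have "common_tail (f * e) x w"
        by (intro moebius_equiv_imp_common_tail[OF irr(1)]) (use e f in auto)
      then obtain i j where ij: "complete_quotient x i = complete_quotient w j"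
        by (auto simp: common_tail_def)
      have tails: "partial_quotient x (i + t) = partial_quotient w (j + t)" for t
        using ij by (metis partial_quotient_complete_quotient)
      \<comment> \<open>The tails match \<open>rev xs\<close> at position \<open>j + t\<close> with \<open>xs\<close> at position \<open>i + t - N\<close>, so the
        rotation is by \<open>i - j - N\<close> modulo \<open>p\<close>. Subtraction is replaced by adding
        \<open>p - 1\<close> times the number, and the multiple \<open>N p\<close> keeps \<open>i + t - N\<close> a natural number.\<close>
      define r where "r = i + (p - 1) * j + (p - 1) * N + N * p"
      have "rotate r xs = rev xs"
      proof (rule nth_equalityI)
        fix s assume "s < length (rotate r xs)"
        then have s: "s < p" by (simp add: p_def)
        define t where "t = s + (p - 1) * j + N * p"
        obtain q where q: "p = Suc q" using pos by (cases p) (auto simp: p_def)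
        have "(j + t) mod p = (s + (j + N) * p) mod p"
          by (simp add: t_def q algebra_simps)
        also have "\<dots> = s" using s by simp
        finally have 1: "partial_quotient w (j + t) = rev xs ! s" by (simp add: b p_def)
        have "N + (i + t - N) = i + t" by (simp add: t_def q)
        then have "partial_quotient x (i + t) = xs ! ((i + t - N) mod p)"
          using a[of "i + t - N"] by (simp add: p_def)
        also have "(i + t - N) mod p = (r + s) mod p"
        proof -
          have "i + t - N + N * p = r + s" by (simp add: t_def r_def q algebra_simps)
          then show ?thesis by (metis mod_mult_self1 mult.commute)
        qed
        finally have 2: "partial_quotient x (i + t) = xs ! ((r + s) mod p)" .
        have "rotate r xs ! s = xs ! ((r + s) mod p)" using s by (simp add: nth_rotate p_def)
        then show "rotate r xs ! s = rev xs ! s" using 1 2 tails[of t] by simp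
      qed simp
      then show ?thesis using xs by (auto simp: palindromic_period_def)
    qed
  qed
qed

section \<open>Invariance of classes under the three involutions\<close>

fun substitute :: "form \<Rightarrow> int \<Rightarrow> int \<Rightarrow> int \<Rightarrow> int \<Rightarrow> form" where
  "substitute (m, n, k) a b c d =
     (m * a\<^sup>2 + n * c\<^sup>2 + k * a * c,
      m * b\<^sup>2 + n * d\<^sup>2 + k * b * d,
      2 * m * a * b + 2 * n * c * d + k * (a * d + b * c))"

lemma form_eval_eq_iff: "(\<forall>v. form_eval f v = form_eval g v) \<longleftrightarrow> f = g"
proof
  assume eq: "\<forall>v. form_eval f v = form_eval g v"
  obtain m n k m' n' k' where fg: "f = (m, n, k)" "g = (m', n', k')" by (metis prod_cases3)
  show "f = g"
    using eq[rule_format, of "vector [1, 0]"] eq[rule_format, of "vector [0, 1]"]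
      eq[rule_format, of "vector [1, 1]"]
    by (simp add: fg)
qed simp

lemma form_eval_matrix:
  fixes A :: "int ^ 2 ^ 2"
  shows "form_eval f (A *v v) = form_eval (substitute f (A $ 1 $ 1) (A $ 1 $ 2) (A $ 2 $ 1) (A $ 2 $ 2)) v"
proof -
  obtain m n k where f: "f = (m, n, k)" by (metis prod_cases3)
  show ?thesis
    by (simp add: f matrix_vector_mult_def sum_2 power2_eq_square algebra_simps)
qed

text \<open>Substitutions of determinant \<open>-1\<close> are needed as well: conjugation and the antipodal
  involution come from such substitutions.\<close>

definition form_equiv :: "int \<Rightarrow> form \<Rightarrow> form \<Rightarrow> bool" where
  "form_equiv e f g \<longleftrightarrow> (\<exists>a b c d. a * d - b * c = e \<and> g = substitute f a b c d)"

lemma form_class_eq: "g \<in> form_class f \<longleftrightarrow> form_equiv 1 f g"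
  unfolding form_equiv_def
proof
  assume "g \<in> form_class f"
  then obtain A :: "int ^ 2 ^ 2" where A: "det A = 1" "\<forall>v. form_eval g v = form_eval f (A *v v)"
    by (auto simp: form_class_def)
  then have "g = substitute f (A $ 1 $ 1) (A $ 1 $ 2) (A $ 2 $ 1) (A $ 2 $ 2)"
    by (simp add: form_eval_matrix form_eval_eq_iff)
  then show "\<exists>a b c d. a * d - b * c = 1 \<and> g = substitute f a b c d"
    using A(1) by (auto simp: det_2)
next
  assume "\<exists>a b c d. a * d - b * c = 1 \<and> g = substitute f a b c d"
  then obtain a b c d where *: "a * d - b * c = 1" "g = substitute f a b c d" by blast
  define A :: "int ^ 2 ^ 2" where "A = vector [vector [a, b], vector [c, d]]"
  have "det A = 1" "\<forall>v. form_eval g v = form_eval f (A *v v)"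
    using * by (simp_all add: A_def det_2 form_eval_matrix)
  then show "g \<in> form_class f" by (auto simp: form_class_def)
qed

lemma substitute_substitute:
  "substitute (substitute f a b c d) a' b' c' d' =
     substitute f (a * a' + b * c') (a * b' + b * d') (c * a' + d * c') (c * b' + d * d')"
  by (cases f) (simp add: power2_eq_square algebra_simps)

lemma substitute_id: "substitute f 1 0 0 1 = f"
  by (cases f) simp

lemma form_equiv_substitute: "a * d - b * c = e \<Longrightarrow> form_equiv e f (substitute f a b c d)"
  by (auto simp: form_equiv_def)

lemma form_equiv_refl: "form_equiv 1 f f"
  using form_equiv_substitute[of 1 1 0 0 1 f] by (simp add: substitute_id)

lemma form_equiv_trans:
  assumes "form_equiv e f g" "form_equiv e' g h" shows "form_equiv (e * e') f h"
proof -
  obtain a b c d where 1: "a * d - b * c = e" "g = substitute f a b c d"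
    using assms(1) by (auto simp: form_equiv_def)
  obtain a' b' c' d' where 2: "a' * d' - b' * c' = e'" "h = substitute g a' b' c' d'"
    using assms(2) by (auto simp: form_equiv_def)
  have "(a * a' + b * c') * (c * b' + d * d') - (a * b' + b * d') * (c * a' + d * c') = e * e'"
    unfolding 1(1)[symmetric] 2(1)[symmetric] by (simp add: algebra_simps)
  then show ?thesis unfolding 1(2) 2(2) substitute_substitute by (rule form_equiv_substitute)
qed

lemma form_equiv_sym:
  assumes "form_equiv e f g" "e = 1 \<or> e = -1" shows "form_equiv e g f"
proof -
  obtain a b c d where *: "a * d - b * c = e" "g = substitute f a b c d"
    using assms(1) by (auto simp: form_equiv_def)
  have ee: "e * (a * d - b * c) = 1" using * assms(2) by auto
  have "a * (e * d) + b * (- e * c) = 1" "a * (- e * b) + b * (e * a) = 0"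
    "c * (e * d) + d * (- e * c) = 0" "c * (- e * b) + d * (e * a) = 1"
    using ee by (simp_all add: algebra_simps)
  then have "substitute g (e * d) (- e * b) (- e * c) (e * a) = f"
    by (simp only: *(2) substitute_substitute substitute_id)
  moreover have "(e * d) * (e * a) - (- e * b) * (- e * c) = e"
    using ee * by (simp add: algebra_simps)
  ultimately show ?thesis by (metis form_equiv_substitute)
qed

fun scale_form :: "int \<Rightarrow> form \<Rightarrow> form" where
  "scale_form s (m, n, k) = (s * m, s * n, s * k)"

lemma substitute_scale_form: "substitute (scale_form s f) a b c d = scale_form s (substitute f a b c d)"
  by (cases f) (simp add: algebra_simps)

lemma form_equiv_scale_form:
  "form_equiv e f g \<Longrightarrow> form_equiv e (scale_form s f) (scale_form s g)"
  by (auto simp: form_equiv_def substitute_scale_form)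

text \<open>Since \<open>\<sigma>\<close> is a fixed substitution \<open>U\<close> of determinant \<open>u\<close> combined with the scaling by \<open>s\<close>, it
  maps classes to classes, and the class of \<open>f\<close> is invariant as soon as it contains \<open>\<sigma> f\<close>. Composing
  with the inverse of \<open>U\<close> trades the membership of \<open>\<sigma> f\<close> for a substitution of determinant \<open>u\<close>
  from \<open>f\<close> to \<open>s f\<close>.\<close>

lemma invariant_under_form_class_iff:
  assumes \<sigma>: "\<And>g. \<sigma> g = substitute (scale_form s g) p q r t"
    and invol: "\<And>g. \<sigma> (\<sigma> g) = g"
    and u: "p * t - q * r = u" "u = 1 \<or> u = -1"
  shows "invariant_under \<sigma> (form_class f) \<longleftrightarrow> form_equiv u f (scale_form s f)"
proof -
  have scaled: "form_equiv u (scale_form s g) (\<sigma> g)" for g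
    unfolding \<sigma> by (rule form_equiv_substitute[OF u(1)])
  have uu: "u * u = 1" "u * 1 = u" "1 * u = u" using u(2) by auto
  have equivariant: "form_equiv 1 (\<sigma> g) (\<sigma> h)" if "form_equiv 1 g h" for g h
    using form_equiv_trans[OF form_equiv_trans[OF form_equiv_sym[OF scaled u(2)]
        form_equiv_scale_form[OF that]] scaled] by (simp add: uu)
  have "invariant_under \<sigma> (form_class f) \<longleftrightarrow> form_equiv 1 f (\<sigma> f)"
  proof
    assume "invariant_under \<sigma> (form_class f)"
    then show "form_equiv 1 f (\<sigma> f)"
      using form_equiv_refl[of f] by (auto simp: invariant_under_def form_class_eq)
  next
    assume *: "form_equiv 1 f (\<sigma> f)"
    have sub: "\<sigma> h \<in> form_class f" if "h \<in> form_class f" for h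
      using form_equiv_trans[OF * equivariant, of h] that by (simp add: form_class_eq)
    then have "h \<in> \<sigma> ` form_class f" if "h \<in> form_class f" for h
      using invol that by (metis imageI)
    then show "invariant_under \<sigma> (form_class f)" using sub by (auto simp: invariant_under_def)
  qed
  also have "\<dots> \<longleftrightarrow> form_equiv u f (scale_form s f)"
    using form_equiv_trans[of 1 f "\<sigma> f" u "scale_form s f"] form_equiv_sym[OF scaled u(2), of f]
      form_equiv_trans[of u f "scale_form s f" u "\<sigma> f"] scaled[of f] by (auto simp: uu)
  finally show ?thesis .
qed

lemma invariant_conjugate_iff:
  "invariant_under conjugate_form (form_class f) \<longleftrightarrow> form_equiv (-1) f (scale_form 1 f)"
proof (rule invariant_under_form_class_iff)
  show "conjugate_form g = substitute (scale_form 1 g) 1 0 0 (-1)" for g by (cases g) simp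
  show "conjugate_form (conjugate_form g) = g" for g by (cases g) simp
qed auto

lemma invariant_adjoint_iff:
  "invariant_under adjoint_form (form_class f) \<longleftrightarrow> form_equiv 1 f (scale_form (-1) f)"
proof (rule invariant_under_form_class_iff)
  show "adjoint_form g = substitute (scale_form (-1) g) 0 1 (-1) 0" for g by (cases g) simp
  show "adjoint_form (adjoint_form g) = g" for g by (cases g) simp
qed auto

lemma invariant_antipodal_iff:
  "invariant_under antipodal_form (form_class f) \<longleftrightarrow> form_equiv (-1) f (scale_form (-1) f)"
proof (rule invariant_under_form_class_iff)
  show "antipodal_form g = substitute (scale_form (-1) g) 0 1 1 0" for g by (cases g) simp
  show "antipodal_form (antipodal_form g) = g" for g by (cases g) simp
qed auto

section \<open>Automorphs of a form and Moebius maps of its roots\<close>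

lemma irrational_sqrt_int:
  fixes D :: int
  assumes "D > 0" "\<not> is_square D" shows "sqrt D \<notin> \<rat>"
proof
  assume "sqrt D \<in> \<rat>"
  then obtain p q :: nat where pq: "q \<noteq> 0" "\<bar>sqrt D\<bar> = p / q" "coprime p q"
    by (rule Rats_abs_nat_div_natE)
  have "real_of_int D = (sqrt D)\<^sup>2" using assms(1) by simp
  also have "\<dots> = (p / q)\<^sup>2" by (metis pq(2) power2_abs)
  finally have "real_of_int D * (real q)\<^sup>2 = (real p)\<^sup>2" using pq(1) by (simp add: field_simps)
  then have "real_of_int (D * (int q)\<^sup>2) = real_of_int ((int p)\<^sup>2)" by simp
  then have eq: "D * (int q)\<^sup>2 = (int p)\<^sup>2" by (simp only: of_int_eq_iff)
  then have "(int q)\<^sup>2 dvd (int p)\<^sup>2" by (metis dvd_triv_right)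
  then have "int q dvd int p" by simp
  then have "q = 1" using pq(3) by (metis coprime_absorb_right int_dvd_int_iff nat_dvd_1_iff_1)
  then have "D = (int p)\<^sup>2" using eq by simp
  then show False using assms(2) by auto
qed

text \<open>Let \<open>F\<close> be the symmetric matrix of the form and \<open>B\<close> the matrix of the substitution. The condition
  \<open>B\<^sup>T F B = s F\<close> is quadratic in \<open>B\<close>, but multiplying it by the adjugate of \<open>B\<^sup>T\<close> turns it into
  \<open>e F B = s adj(B\<^sup>T) F\<close>, which is linear. The first row of this equation gives the conditions on
  the right. For \<open>s = e\<close> they say that \<open>B\<close> preserves the roots, for \<open>s = - e\<close> that it has trace zero
  and exchanges them.\<close>

lemma substitute_eq_scaled_iff:
  fixes m n k a b c d e :: int
  assumes det: "a * d - b * c = e" and e: "e = 1 \<or> e = -1" and m: "m \<noteq> 0"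
  shows "substitute (m, n, k) a b c d = scale_form e (m, n, k) \<longleftrightarrow> m * (a - d) = - k * c \<and> m * b = - n * c" (is ?fix)
    and "substitute (m, n, k) a b c d = scale_form (- e) (m, n, k) \<longleftrightarrow> a + d = 0 \<and> k * a = m * b - n * c" (is ?swap)
proof -
  have ee: "e * e = 1" using e by auto
  have linear: "e * (2 * m * a + k * c) = s * (2 * m * d - k * c)"
      "e * (2 * m * b + k * d) = s * (k * d - 2 * n * c)"
    if "substitute (m, n, k) a b c d = scale_form s (m, n, k)" for s
  proof -
    have s: "m * a\<^sup>2 + n * c\<^sup>2 + k * a * c = s * m" "m * b\<^sup>2 + n * d\<^sup>2 + k * b * d = s * n"
      "2 * m * a * b + 2 * n * c * d + k * (a * d + b * c) = s * k" using that by auto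
    show "e * (2 * m * a + k * c) = s * (2 * m * d - k * c)"
      "e * (2 * m * b + k * d) = s * (k * d - 2 * n * c)"
      using s det by algebra+
  qed
  show ?fix
  proof
    assume "substitute (m, n, k) a b c d = scale_form e (m, n, k)"
    then show "m * (a - d) = - k * c \<and> m * b = - n * c"
      using linear[of e] e by (auto simp: algebra_simps)
  next
    assume *: "m * (a - d) = - k * c \<and> m * b = - n * c"
    then have "m * a\<^sup>2 + n * c\<^sup>2 + k * a * c = e * m" using det by algebra
    moreover have "m * (m * b\<^sup>2 + n * d\<^sup>2 + k * b * d) = m * (e * n)" using * det by algebra
    moreover have "m * (2 * m * a * b + 2 * n * c * d + k * (a * d + b * c)) = m * (e * k)" using * det by algebra
    ultimately show "substitute (m, n, k) a b c d = scale_form e (m, n, k)" using m by simp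
  qed
  show ?swap
  proof
    assume "substitute (m, n, k) a b c d = scale_form (- e) (m, n, k)"
    then have 1: "2 * (m * (a + d)) = 0" "2 * (m * b + k * d) = 2 * (n * c)"
      using linear[of "- e"] e by (auto simp: algebra_simps)
    then have "a + d = 0" using m by simp
    moreover have "k * a = m * b - n * c" using 1(2) calculation by algebra
    ultimately show "a + d = 0 \<and> k * a = m * b - n * c" by simp
  next
    assume *: "a + d = 0 \<and> k * a = m * b - n * c"
    then have "m * a\<^sup>2 + n * c\<^sup>2 + k * a * c = - e * m" using det by algebra
    moreover have "m * b\<^sup>2 + n * d\<^sup>2 + k * b * d = - e * n" using * det by algebra
    moreover have "2 * m * a * b + 2 * n * c * d + k * (a * d + b * c) = - e * k" using * det by algebra
    ultimately show "substitute (m, n, k) a b c d = scale_form (- e) (m, n, k)" by simp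
  qed
qed

context
  fixes m n k :: int and x x' :: real
  assumes m: "m \<noteq> 0" and irr: "x \<notin> \<rat>"
    and sum: "m * (x + x') = - k" and prod: "m * (x * x') = n"
begin

lemma root_eq: "m * x\<^sup>2 = - k * x - n"
proof -
  have "m * x\<^sup>2 = x * (m * (x + x')) - m * (x * x')" by (simp add: power2_eq_square algebra_simps)
  then show ?thesis unfolding sum prod by (simp add: algebra_simps)
qed

text \<open>Here and in the next lemma, clearing denominators and using the sum and product of the roots
  leaves an integral linear relation in the irrational \<open>x\<close>, so both its coefficients vanish.\<close>

lemma moebius_fix_iff:
  fixes a b c d :: int
  assumes "a * d - b * c \<noteq> 0"
  shows "x = (a * x + b) / (c * x + d) \<longleftrightarrow> m * (a - d) = - k * c \<and> m * b = - n * c"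
proof -
  have nz: "c * x + d \<noteq> 0" using irrational_linear_eq_0[OF irr, of c d] assms by auto
  then have "x = (a * x + b) / (c * x + d) \<longleftrightarrow> m * (x * (c * x + d)) = m * (a * x + b)"
    using m by (simp add: nonzero_eq_divide_eq)
  also have "m * (x * (c * x + d)) = c * (m * x\<^sup>2) + m * d * x" by (simp add: power2_eq_square algebra_simps)
  also have "\<dots> = m * (a * x + b) \<longleftrightarrow> (- k * c - m * (a - d) :: int) * x + (- n * c - m * b :: int) = 0"
    unfolding root_eq by (auto simp: algebra_simps)
  also have "\<dots> \<longleftrightarrow> m * (a - d) = - k * c \<and> m * b = - n * c"
    unfolding irrational_linear_eq_0[OF irr] by auto
  finally show ?thesis .
qed

lemma moebius_swap_iff:
  fixes a b c d :: int
  assumes "a * d - b * c \<noteq> 0"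
  shows "x' = (a * x + b) / (c * x + d) \<longleftrightarrow> a + d = 0 \<and> k * a = m * b - n * c"
proof -
  have nz: "c * x + d \<noteq> 0" using irrational_linear_eq_0[OF irr, of c d] assms by auto
  then have "x' = (a * x + b) / (c * x + d) \<longleftrightarrow> m * (x' * (c * x + d)) = m * (a * x + b)"
    using m by (simp add: nonzero_eq_divide_eq)
  also have "m * (x' * (c * x + d)) = c * (m * (x * x')) + d * (m * (x + x')) - m * d * x"
    by (simp add: algebra_simps)
  also have "\<dots> = m * (a * x + b) \<longleftrightarrow> (m * (a + d) :: int) * x + (m * b - n * c + k * d :: int) = 0"
    unfolding sum prod by (auto simp: algebra_simps)
  also have "\<dots> \<longleftrightarrow> a + d = 0 \<and> k * a = m * b - n * c"
  proof -
    have "k * d = - k * a" if "a + d = 0" using that by (simp add: add_eq_0_iff)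
    then show ?thesis unfolding irrational_linear_eq_0[OF irr] using m by auto
  qed
  finally show ?thesis .
qed

lemma form_equiv_scale_iff_moebius:
  assumes e: "e = 1 \<or> e = -1"
  shows "form_equiv e (m, n, k) (scale_form e (m, n, k)) \<longleftrightarrow> moebius_equiv e x x"
    and "form_equiv e (m, n, k) (scale_form (- e) (m, n, k)) \<longleftrightarrow> moebius_equiv e x x'"
proof -
  have fix_iff: "scale_form e (m, n, k) = substitute (m, n, k) a b c d \<longleftrightarrow> x = (a * x + b) / (c * x + d)"
    and swap_iff: "scale_form (- e) (m, n, k) = substitute (m, n, k) a b c d \<longleftrightarrow> x' = (a * x + b) / (c * x + d)"
    if "a * d - b * c = e" for a b c d
  proof -
    have "a * d - b * c \<noteq> 0" using that e by auto
    then show "scale_form e (m, n, k) = substitute (m, n, k) a b c d \<longleftrightarrow> x = (a * x + b) / (c * x + d)"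
      "scale_form (- e) (m, n, k) = substitute (m, n, k) a b c d \<longleftrightarrow> x' = (a * x + b) / (c * x + d)"
      using substitute_eq_scaled_iff[OF that e m] moebius_fix_iff moebius_swap_iff
      by (metis (no_types))+
  qed
  show "form_equiv e (m, n, k) (scale_form e (m, n, k)) \<longleftrightarrow> moebius_equiv e x x"
    unfolding form_equiv_def moebius_equiv_def using fix_iff by (metis (no_types))
  show "form_equiv e (m, n, k) (scale_form (- e) (m, n, k)) \<longleftrightarrow> moebius_equiv e x x'"
    unfolding form_equiv_def moebius_equiv_def using swap_iff by (metis (no_types))
qed

end

theorem theorem3p8:
  fixes m n k :: int
  assumes "k\<^sup>2 - 4 * m * n > 0"
    and "\<not> is_square (k\<^sup>2 - 4 * m * n)"
  shows "(\<not> palindromic_period (form_period (m, n, k)) \<and> odd_period (form_period (m, n, k)))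
    \<longleftrightarrow> antisymmetric_class (form_class (m, n, k))"
proof -
  define r where "r = sqrt (real_of_int (k\<^sup>2 - 4 * m * n))"
  define x where "x = (- real_of_int k + r) / (2 * real_of_int m)"
  define x' where "x' = (- real_of_int k - r) / (2 * real_of_int m)"
  have m: "m \<noteq> 0" using assms(2) by auto
  have r: "r \<notin> \<rat>" unfolding r_def by (rule irrational_sqrt_int[OF assms])
  have rr: "r * r = real_of_int (k\<^sup>2 - 4 * m * n)" using assms(1) by (simp add: r_def del: of_int_diff)
  have x: "x \<notin> \<rat>"
  proof
    assume "x \<in> \<rat>"
    then have "x * (2 * m) + k \<in> \<rat>" by (intro Rats_add Rats_mult) auto
    then show False using r m by (simp add: x_def)
  qed
  have sum: "m * (x + x') = - k" using m by (simp add: x_def x'_def field_simps)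
  have "x * x' = (k\<^sup>2 - r * r) / (4 * m\<^sup>2)"
    using m by (simp add: x_def x'_def field_simps power2_eq_square)
  then have prod: "m * (x * x') = n" using m by (simp add: rr power2_eq_square)
  have conj: "rational_conjugates x x'"
  proof -
    have "x + x' = - k / m" "x * x' = n / m" using sum prod m by (simp_all add: field_simps)
    then show ?thesis using x by (simp add: rational_conjugates_def Rats_divide)
  qed
  \<comment> \<open>The period is defined through \<open>\<bar>x\<bar>\<close>. For negative \<open>x\<close> the change of sign has determinant
    \<open>-1\<close>, but it acts on source and target of a map alike, so the determinant of the map is kept.\<close>
  obtain z z' e where z: "z = \<bar>x\<bar>" "rational_conjugates z z'" "e = 1 \<or> e = -1"
    "moebius_equiv e x z" "moebius_equiv e x' z'"
  proof (cases "x \<ge> 0")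
    case True
    then show ?thesis using that[of x x' 1] conj by (simp add: moebius_equiv_refl)
  next
    case False
    have "rational_conjugates (- x) (- x')"
      using conj unfolding rational_conjugates_def
      by (metis Rats_minus_iff minus_add_distrib minus_mult_minus)
    then show ?thesis using that[of "- x" "- x'" "-1"] False by (simp add: moebius_equiv_uminus)
  qed
  note z_irr = rational_conjugates_irrational[OF z(2)]
  have x'_irr: "x' \<notin> \<rat>" using rational_conjugates_irrational[OF conj] by simp
  have transport: "moebius_equiv f z w' \<longleftrightarrow> moebius_equiv f x w"
    if "f = 1 \<or> f = -1" "moebius_equiv e w w'" "w \<notin> \<rat>" "w' \<notin> \<rat>" for f w w'
  proof
    have zx: "moebius_equiv e z x" and w'w: "moebius_equiv e w' w"
      using moebius_equiv_sym z(3,4) x that by auto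
    have ee: "e * f * e = f" "e \<noteq> 0" "f \<noteq> 0" "e * f \<noteq> 0" using z(3) that(1) by auto
    show "moebius_equiv f x w" if "moebius_equiv f z w'"
      using moebius_equiv_trans[OF moebius_equiv_trans[OF z(4) that x ee(2,3)] w'w x ee(4,2)] ee(1) by simp
    show "moebius_equiv f z w'" if "moebius_equiv f x w"
      using moebius_equiv_trans[OF moebius_equiv_trans[OF zx that z_irr(1) ee(2,3)] \<open>moebius_equiv e w w'\<close> z_irr(1) ee(4,2)] ee(1)
      by simp
  qed
  let ?P = "minimal_blocks (partial_quotient z)"
  have P: "form_period (m, n, k) = ?P" by (simp add: form_period_def z(1) x_def r_def)
  have odd: "odd_period ?P \<longleftrightarrow> invariant_under antipodal_form (form_class (m, n, k))"
    using odd_period_iff[OF z_irr(1)] transport[of "-1" x z] z(4) x z_irr(1)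
      form_equiv_scale_iff_moebius(1)[OF m x sum prod, of "-1"] by (simp add: invariant_antipodal_iff)
  have pal: "palindromic_period ?P \<longleftrightarrow> invariant_under conjugate_form (form_class (m, n, k)) \<or>
      invariant_under adjoint_form (form_class (m, n, k))" if "odd_period ?P"
  proof -
    have "?P \<noteq> {}" using that by (auto simp: odd_period_def)
    from palindromic_period_iff[OF z(2) this] show ?thesis
      using transport[of "-1" x' z'] transport[of 1 x' z'] z(5) x'_irr z_irr(2)
        form_equiv_scale_iff_moebius(2)[OF m x sum prod, of "-1"]
        form_equiv_scale_iff_moebius(2)[OF m x sum prod, of 1]
      by (auto simp: invariant_conjugate_iff invariant_adjoint_iff)
  qed
  show ?thesis
    unfolding antisymmetric_class_def P using odd pal by blast
qed

end
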